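(* For $n\ge 1$ let $\bar{P}_n = (\mathcal{S}_n \smallsetminus \{e\}, \preceq)$ be the proper part of the absolute order on the symmetric group $\mathcal{S}_n$, and let $\Delta(\bar P_n)$ be its order complex. The reduced Euler characteristics $\tilde{\chi}(\Delta(\bar P_n))$ satisfy the identity of formal power series $$\sum_{n \ge 1} (-1)^n \, \tilde{\chi} (\Delta (\bar{P}_n)) \, \frac{t^n}{n!} \ = \ 1 - C(t) \exp \left\{ -2t \, C(t) \right\},$$ where $C(t) = \frac{1}{2t} \, (1 - \sqrt{1-4t})$ is the ordinary generating function for the Catalan numbers.
   Context: Let $\mathcal{S}_n$ be the symmetric group on $[n]=\{1,\dots,n\}$ with identity $e$, and let $T$ be the set of all transpositions in $\mathcal{S}_n$. For $w\in \mathcal{S}_n$ let $\ell_T(w)$ be the smallest integer $k$ such that $w$ is a product of $k$ elements of $T$. The absolute order $\preceq$ on $\mathcal{S}_n$ is the partial order defined by $u \preceq v$ if and only if $\ell_T(u)+\ell_T(u^{-1}v)=\ell_T(v)$. The order complex $\Delta(P)$ of a finite poset $P$ is the abstract simplicial complex with vertex set $P$ whose faces are the chains of $P$ (including the empty chain). The reduced Euler characteristic of a finite simplicial complex $\Delta$ is $\tilde\chi(\Delta)=\sum_{F\in\Delta}(-1)^{\dim F}$, where $\dim F=\#F-1$ and the sum includes the empty face (of dimension $-1$). The power series $C(t)$ equals $\sum_{m\ge 0} C_m t^m$ with $C_m=\frac{1}{m+1}\binom{2m}{m}$. *)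

theory Defs
  imports
    "HOL-Combinatorics.Permutations"
    "HOL-Computational_Algebra.Formal_Power_Series"
begin

section \<open>The absolute order on the symmetric group\<close>

definition sym_perms :: "nat \<Rightarrow> (nat \<Rightarrow> nat) set" where
  "sym_perms n = {w. w permutes {1..n}}"

definition transpositions :: "nat \<Rightarrow> (nat \<Rightarrow> nat) set" where
  "transpositions n = {transpose a b | a b. a \<in> {1..n} \<and> b \<in> {1..n} \<and> a \<noteq> b}"

definition abs_length :: "nat \<Rightarrow> (nat \<Rightarrow> nat) \<Rightarrow> nat" where
  "abs_length n w =
     (LEAST k. \<exists>ts. length ts = k \<and> set ts \<subseteq> transpositions n \<and> w = foldr (\<circ>) ts id)"

text \<open>To be used for \<open>u, v \<in> sym_perms n\<close> only.\<close>

definition abs_le :: "nat \<Rightarrow> (nat \<Rightarrow> nat) \<Rightarrow> (nat \<Rightarrow> nat) \<Rightarrow> bool" where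
  "abs_le n u v \<longleftrightarrow> abs_length n u + abs_length n (inv u \<circ> v) = abs_length n v"


section \<open>Order complexes and the reduced Euler characteristic\<close>

text \<open>
  A finite abstract simplicial complex is represented by the set of its faces, the empty face
  included.
\<close>

definition order_complex :: "'a set \<Rightarrow> ('a \<Rightarrow> 'a \<Rightarrow> bool) \<Rightarrow> 'a set set" where
  "order_complex P le = {F. F \<subseteq> P \<and> Complete_Partial_Order.chain le F}"

definition face_dim :: "'a set \<Rightarrow> int" where
  "face_dim F = int (card F) - 1"

text \<open>
  The value is an integer; it is given type \<^typ>\<open>real\<close> because the empty face requires a
  negative exponent.
\<close>

definition reduced_euler_char :: "'a set set \<Rightarrow> real" where
  "reduced_euler_char \<Delta> = (\<Sum>F\<in>\<Delta>. (-1) powi face_dim F)"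


section \<open>The Catalan generating function\<close>

definition catalan :: "nat \<Rightarrow> real" where
  "catalan m = 1 / (real m + 1) * real ((2 * m) choose m)"

definition catalan_fps :: "real fps" where
  "catalan_fps = Abs_fps catalan"

lemma catalan_0: "catalan 0 = 1"
  by (simp add: catalan_def)

lemma catalan_Suc: "(real m + 2) * catalan (Suc m) = 2 * (2 * real m + 1) * catalan m"
proof -
  have c: "catalan k = fact (2 * k) / (fact k * fact k * (real k + 1))" for k
    by (simp add: catalan_def binomial_fact mult_ac flip: mult_2)
  have f: "fact (2 * Suc m) = (2 * real m + 2) * (2 * real m + 1) * fact (2 * m)"
    by (simp add: algebra_simps)
  show ?thesis
    unfolding c f by (simp add: divide_simps) (simp add: algebra_simps)
qed

lemma gbinomial_half_catalan:
  "((1/2::real) gchoose Suc m) * (-4) ^ Suc m = - 2 * catalan m"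
proof (induction m)
  case 0
  show ?case by (simp add: catalan_0)
next
  case (Suc m)
  define g h :: real where "g = (1/2) gchoose Suc m" and "h = (1/2) gchoose Suc (Suc m)"
  have "(real m + 2) * h = (1/2 - (real m + 1)) * g"
    using gbinomial_absorb_comp[of "1/2::real" "Suc m"]
      gbinomial_absorption[of "Suc m" "1/2::real"]
    by (simp add: g_def h_def algebra_simps)
  then have "((real m + 2) * h) * (-4) ^ Suc (Suc m)
      = ((1/2 - (real m + 1)) * g) * (-4) ^ Suc (Suc m)"
    by (rule arg_cong)
  then have "(real m + 2) * (h * (-4) ^ Suc (Suc m))
      = (1/2 - (real m + 1)) * (-4) * (g * (-4) ^ Suc m)"
    by (simp only: power_Suc mult_ac)
  also have "\<dots> = (real m + 2) * (- 2 * catalan (Suc m))"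
    unfolding g_def Suc.IH using catalan_Suc[of m] by (simp add: algebra_simps)
  finally show ?case
    unfolding h_def by (subst (asm) mult_cancel_left) auto
qed

text \<open>The closed form \<open>C(t) = (1 - \<surd>(1 - 4t)) / (2t)\<close>, as an identity of formal power series.\<close>

lemma catalan_fps_closed_form:
  "2 * fps_X * catalan_fps = 1 - fps_radical root 2 (1 - 4 * fps_X)"
proof -
  define S :: "real fps" where "S = fps_binomial (1/2) oo (fps_const (-4) * fps_X)"
  have eq: "S = 1 - 2 * fps_X * catalan_fps"
  proof (rule fps_ext)
    fix n
    show "fps_nth S n = fps_nth (1 - 2 * fps_X * catalan_fps) n"
    proof (cases n)
      case 0
      then show ?thesis by (simp add: S_def)
    next
      case (Suc m)
      then have "fps_nth S n = - 2 * catalan m"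
        using gbinomial_half_catalan[of m]
        unfolding S_def fps_compose_linear by (simp add: mult_ac)
      then show ?thesis
        using Suc by (simp add: catalan_fps_def mult.assoc numeral_fps_const)
    qed
  qed
  have "S ^ 2 = 1 - 4 * fps_X"
  proof -
    have "S ^ 2 = (fps_binomial (1/2) * fps_binomial (1/2)) oo (fps_const (-4) * fps_X)"
      unfolding S_def power2_eq_square by (subst fps_compose_mult_distrib) auto
    also have "fps_binomial (1/2) * fps_binomial (1/2) = (1 + fps_X :: real fps)"
      by (simp flip: fps_binomial_add_mult add: fps_binomial_1)
    finally show ?thesis
      by (simp add: fps_compose_add_distrib numeral_fps_const flip: fps_const_neg)
  qed
  moreover have "fps_nth S 0 = 1" by (simp add: S_def)
  ultimately have "S = fps_radical root 2 (1 - 4 * fps_X)"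
    using radical_unique[of root 1 "1 - 4 * fps_X" S]
    by (simp add: numeral_2_eq_2)
  then show ?thesis
    using eq by (metis diff_diff_eq2 add_diff_cancel_left')
qed

end

theory Submission
  imports Defs "HOL-Combinatorics.Orbits"
begin

text \<open>
  Adjoin a greatest element to the absolute order. By Philip Hall's theorem the reduced Euler
  characteristic of the proper part is then the value of the Moebius function at the pair of
  extreme elements, that is, \<open>- (\<Sum>w. \<mu> w)\<close>, where \<open>w\<close> ranges over the symmetric group and
  \<open>\<mu> w\<close> is the Moebius function of the interval from the identity to \<open>w\<close>. So two things have to
  be known: the values \<open>\<mu> w\<close>, and their sum over all permutations.

  The function \<open>\<mu>\<close> is the product over the cycles \<open>c\<close> of \<open>w\<close> of
  \<open>(-1) ^ (k - 1) * C\<^sub>k\<^sub>-\<^sub>1\<close> with \<open>k = card c\<close> and \<open>C\<^sub>m\<close> the Catalan numbers. The usual proof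
  identifies the interval below a cycle with a lattice of noncrossing partitions. Here it is
  enough to check that this product has the defining property of the Moebius function,
  \<open>(\<Sum>u\<preceq>w. \<mu> u) = 0\<close> for \<open>w \<noteq> id\<close>, and this follows from two facts about the
  multiplication of a permutation by a transposition \<open>(a b)\<close> on the left. First, it cuts a cycle
  through \<open>a\<close> and \<open>b\<close> into two, and fuses the cycles of \<open>a\<close> and \<open>b\<close> if they are different; hence
  the absolute length of a permutation of \<open>n\<close> points is \<open>n\<close> minus its number of cycles
  (\<open>abs_length_plus_cycles\<close>), and it changes by exactly one. Secondly, if \<open>a\<close> lies on a
  cycle of length \<open>k\<close>, then the choices of \<open>b \<noteq> a\<close> on that cycle cut it into pieces of lengths
  \<open>i\<close> and \<open>k - i\<close>, for each \<open>i\<close> with \<open>0 < i < k\<close> once, and by the Catalan convolution the values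
  \<open>\<mu> ((a b) w)\<close> for these \<open>b\<close> add up to \<open>- \<mu> w\<close> (\<open>sum_cycle_weight_transpose\<close>). Grouping the pairs
  \<open>(u, u\<^sup>-\<^sup>1 w)\<close> according to the point to which the second component sends \<open>a\<close> makes the sum over
  \<open>u \<preceq> w\<close> a sum of expressions that vanish for this reason (\<open>sum_absolute_moebius_below\<close>).

  The sum of a product of cycle weights \<open>g (card c)\<close> over all permutations of \<open>n\<close> points is governed
  by the exponential formula, which appears here as the recurrence
  \<open>(n + 1) \<beta>\<^sub>n\<^sub>+\<^sub>1 = (\<Sum>i\<le>n. g (i + 1) \<beta>\<^sub>n\<^sub>-\<^sub>i)\<close> for the normalised sums (\<open>sum_cycle_weight\<close>). After a
  change of signs the recurrence for the Catalan weights says that the generating function \<open>Y\<close>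
  satisfies \<open>Y' = - C Y\<close> and \<open>Y(0) = 1\<close>. The series \<open>C exp (-2 t C)\<close> solves the same initial value
  problem (\<open>catalan_exp_deriv\<close>), because \<open>C = 1 + t C\<^sup>2\<close>.
\<close>

section \<open>Permutations times a transposition\<close>

lemma orbit_of_cyclic_sequence:
  assumes "0 < m" "\<And>j. Suc j < m \<Longrightarrow> f (x j) = x (Suc j)" "f (x (m - 1)) = x 0"
  shows "orbit f (x 0) = x ` {..<m}"
proof -
  have x: "j < m \<Longrightarrow> (f ^^ j) (x 0) = x j" for j
    by (induction j) (auto simp: assms(2))
  have "(f ^^ m) (x 0) = f ((f ^^ (m - 1)) (x 0))"
    using \<open>0 < m\<close> by (cases m) auto
  then have "orbit f (x 0) = {(f ^^ j) (x 0) | j. j < m}"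
    using assms(1,3) by (intro orbit_altdef_bounded) (simp_all add: x)
  then show ?thesis
    using x by (auto simp: image_def) metis
qed

lemma orbit_enumeration:
  assumes "permutation w"
  shows "bij_betw (\<lambda>i. (w ^^ i) a) {..<card (orbit w a)} (orbit w a)"
    and "(w ^^ card (orbit w a)) a = a"
    and "card (orbit w a) > 0"
proof -
  have a: "a \<in> orbit w a"
    using assms by (rule permutation_self_in_orbit)
  have "bij_betw (\<lambda>i. (w ^^ i) a) {0..<funpow_dist1 w a a} (orbit w a)"
    unfolding bij_betw_def using inj_on_funpow_dist1[OF a] orbit_conv_funpow_dist1[OF a] by simp
  moreover from this have "card (orbit w a) = funpow_dist1 w a a"
    by (metis bij_betw_same_card card_atLeastLessThan minus_nat.diff_0)
  ultimately show "bij_betw (\<lambda>i. (w ^^ i) a) {..<card (orbit w a)} (orbit w a)"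
    "(w ^^ card (orbit w a)) a = a" "card (orbit w a) > 0"
    using funpow_dist1_prop[OF a] by (simp_all add: atLeast0LessThan)
qed

lemma orbit_eq_if_mem: "permutation w \<Longrightarrow> y \<in> orbit w a \<Longrightarrow> orbit w y = orbit w a"
  using cyclic_on_orbit' orbit_cyclic_eq3 by metis

text \<open>
  Write the cycle of \<open>a\<close> as \<open>x\<^sub>0 = a, x\<^sub>1, \<dots>\<close> with \<open>b = x\<^sub>i\<close>. The composition with the
  transposition only redirects two arrows: the predecessor \<open>x\<^sub>i\<^sub>-\<^sub>1\<close> of \<open>b\<close> now goes to \<open>a\<close>, and the
  predecessor \<open>x\<^sub>k\<^sub>-\<^sub>1\<close> of \<open>a\<close> goes to \<open>b\<close>. So the arcs \<open>x\<^sub>0, \<dots>, x\<^sub>i\<^sub>-\<^sub>1\<close> and \<open>x\<^sub>i, \<dots>, x\<^sub>k\<^sub>-\<^sub>1\<close> close up.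
\<close>

lemma transpose_splits_orbit:
  fixes w a i
  defines "b \<equiv> (w ^^ i) a" and "k \<equiv> card (orbit w a)"
  defines "w' \<equiv> transpose a b \<circ> w"
  assumes w: "permutation w" and i: "0 < i" "i < k"
  shows "orbit w' a \<union> orbit w' b = orbit w a" and "orbit w' a \<inter> orbit w' b = {}"
    and "card (orbit w' a) = i" and "card (orbit w' b) = k - i"
proof -
  let ?x = "\<lambda>j. (w ^^ j) a"
  have bij: "bij_betw ?x {..<k} (orbit w a)" and wk: "?x k = a"
    using orbit_enumeration[OF w, of a] by (simp_all add: k_def)
  have inj: "j < k \<Longrightarrow> l < k \<Longrightarrow> ?x j = ?x l \<longleftrightarrow> j = l" for j l
    using bij by (auto simp: bij_betw_def inj_on_def)
  have step: "w' (?x j) = ?x (Suc j)" if "Suc j < k" "Suc j \<noteq> i" for j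
    using that inj[of "Suc j" 0] inj[of "Suc j" i] i
    by (simp add: w'_def b_def transpose_apply_other)
  have A: "orbit w' a = ?x ` {..<i}"
  proof -
    have "w' (?x (i - 1)) = a"
      using i by (cases i) (auto simp: w'_def b_def)
    then show ?thesis
      using orbit_of_cyclic_sequence[of i w' ?x] i step by simp
  qed
  have B: "orbit w' b = ?x ` {i..<k}"
  proof -
    have "w' (?x (k - 1)) = b"
      using i wk by (cases k) (auto simp: w'_def b_def)
    then have "orbit w' (?x i) = (\<lambda>j. ?x (i + j)) ` {..<k - i}"
      using orbit_of_cyclic_sequence[of "k - i" w' "\<lambda>j. ?x (i + j)"] i step
      by (simp add: b_def)
    moreover have "(\<lambda>j. ?x (i + j)) ` {..<k - i} = ?x ` ((+) i ` {..<k - i})"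
      by (simp add: image_image)
    moreover have "(+) i ` {..<k - i} = {i..<k}"
      using i by (auto simp: image_def) (metis add_diff_inverse_nat diff_less_mono lessThan_iff not_less)
    ultimately show ?thesis by (simp add: b_def)
  qed
  have "{..<i} \<union> {i..<k} = {..<k}" using i by auto
  then show "orbit w' a \<union> orbit w' b = orbit w a"
    unfolding A B using bij by (metis bij_betw_def image_Un)
  show "orbit w' a \<inter> orbit w' b = {}"
    unfolding A B using i inj by force
  show "card (orbit w' a) = i" "card (orbit w' b) = k - i"
    unfolding A B using i inj by (subst card_image; auto simp: inj_on_def)+
qed

text \<open>
  Starting from \<open>a\<close>, the new permutation follows the old cycle of \<open>a\<close> until it reaches the
  predecessor of \<open>a\<close>, which is now sent to \<open>b\<close>.
\<close>

lemma transpose_merges_orbits: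
  assumes w: "permutation w" and "b \<notin> orbit w a"
  shows "b \<in> orbit (transpose a b \<circ> w) a"
proof -
  define w' where "w' = transpose a b \<circ> w"
  have wb: "w x \<noteq> b" if "x \<in> orbit w a" for x
    using that assms(2) orbit.step by metis
  have a: "a \<in> orbit w a" by (rule permutation_self_in_orbit[OF w])
  have reach: "x \<in> orbit w' a \<or> b \<in> orbit w' a" if "x \<in> orbit w a" for x
    using that
  proof induction
    case base
    have "w' a \<in> orbit w' a" by (rule orbit.base)
    moreover have "w' a = b \<or> w' a = w a"
      using wb[OF a] by (cases "w a = a") (simp_all add: w'_def)
    ultimately show ?case by metis
  next
    case (step x)
    moreover have "w' x = b \<or> w' x = w x"
      using wb[of x] step.hyps by (cases "w x = a") (simp_all add: w'_def)
    ultimately show ?case using orbit.step[of x w' a] by metis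
  qed
  obtain x where x: "x \<in> orbit w a" "w x = a"
    using a by (metis orbit.simps)
  then have "w' x = b" by (simp add: w'_def)
  then show ?thesis
    using reach[OF x(1)] orbit.step[of x w' a] unfolding w'_def by metis
qed

definition cycles :: "'a set \<Rightarrow> ('a \<Rightarrow> 'a) \<Rightarrow> 'a set set" where
  "cycles S w = orbit w ` S"

lemma finite_cycles [simp]: "finite S \<Longrightarrow> finite (cycles S w)"
  by (simp add: cycles_def)

lemma permutation_of_permutes: "finite S \<Longrightarrow> w permutes S \<Longrightarrow> permutation w"
  using permutation_permutes by blast

text \<open>
  A transposition of two points of one cycle changes the values of \<open>w\<close> on this cycle only, so that
  all other cycles survive.
\<close>

lemma cycles_transpose:
  assumes S: "finite S" "w permutes S" and a: "a \<in> S" and b: "b \<in> orbit w a" "b \<noteq> a"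
  defines "w' \<equiv> transpose a b \<circ> w"
  shows "cycles S w - {orbit w a} = cycles S w' - {orbit w' a, orbit w' b}"
    and "b \<notin> orbit w' a"
proof -
  have w: "permutation w" using S by (rule permutation_of_permutes)
  then have w': "permutation w'"
    unfolding w'_def by (simp add: permutation_compose permutation_swap_id)
  obtain i where i: "i < card (orbit w a)" "b = (w ^^ i) a"
    using b(1) orbit_enumeration(1)[OF w, of a] by (auto simp: bij_betw_def)
  with b(2) have "0 < i" by (cases i) auto
  note split = transpose_splits_orbit(1,2)[OF w \<open>0 < i\<close> i(1), folded i(2), folded w'_def]
  have bw: "b \<in> orbit w' b" and aw: "a \<in> orbit w' a"
    using permutation_self_in_orbit[OF w'] by auto
  then show "b \<notin> orbit w' a" using split(2) by auto
  have out: "orbit w' y = orbit w y" if "y \<notin> orbit w a" for y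
  proof (rule orbit_cong)
    show "y \<in> orbit w y" by (rule permutation_self_in_orbit[OF w])
    fix s assume "s \<in> orbit w y"
    then have "orbit w (w s) = orbit w y"
      using orbit_eq_if_mem[OF w] orbit.step by metis
    then have "w s \<noteq> a" "w s \<noteq> b"
      using that b(1) orbit_eq_if_mem[OF w] permutation_self_in_orbit[OF w] by metis+
    then show "w' s = w s" by (simp add: w'_def)
  qed
  have ins: "orbit w' y \<in> {orbit w' a, orbit w' b}" if "y \<in> orbit w a" for y
    using that split(1) orbit_eq_if_mem[OF w'] by (metis UnE insertCI)
  have outne: "orbit w y \<noteq> orbit w a \<and> orbit w y \<notin> {orbit w' a, orbit w' b}" if "y \<notin> orbit w a" for y
    using that split(1) permutation_self_in_orbit[OF w] by (metis UnI1 UnI2 insertE singletonD)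
  have "cycles S w - {orbit w a} = orbit w ` (S - orbit w a)"
    using orbit_eq_if_mem[OF w] outne by (auto simp: cycles_def)
  moreover have "cycles S w' - {orbit w' a, orbit w' b} = orbit w ` (S - orbit w a)"
  proof (intro set_eqI iffI)
    fix O' assume "O' \<in> cycles S w' - {orbit w' a, orbit w' b}"
    then obtain y where y: "y \<in> S" "O' = orbit w' y" "O' \<notin> {orbit w' a, orbit w' b}"
      by (auto simp: cycles_def)
    then have "y \<notin> orbit w a" using ins by blast
    then show "O' \<in> orbit w ` (S - orbit w a)" using y out by auto
  next
    fix O' assume "O' \<in> orbit w ` (S - orbit w a)"
    then obtain y where y: "y \<in> S" "O' = orbit w y" "y \<notin> orbit w a" by auto
    then have "O' = orbit w' y" using out by simp
    then show "O' \<in> cycles S w' - {orbit w' a, orbit w' b}"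
      using outne[OF y(3)] y by (auto simp: cycles_def)
  qed
  ultimately show "cycles S w - {orbit w a} = cycles S w' - {orbit w' a, orbit w' b}"
    by simp
qed

lemma card_cycles_transpose:
  assumes S: "finite S" "w permutes S" and a: "a \<in> S" and b: "b \<in> orbit w a" "b \<noteq> a"
  shows "card (cycles S (transpose a b \<circ> w)) = Suc (card (cycles S w))"
proof -
  let ?w' = "transpose a b \<circ> w"
  have bS: "b \<in> S" using permutes_orbit_subset[OF S(2) a] b(1) by auto
  have w': "permutation ?w'"
    using S a bS by (meson permutation_of_permutes permutes_compose permutes_swap_id)
  note c = cycles_transpose[OF S a b]
  have ne: "orbit ?w' a \<noteq> orbit ?w' b" using c(2) permutation_self_in_orbit[OF w', of b] by auto
  have "card (cycles S w - {orbit w a}) = card (cycles S w) - 1"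
    using a by (intro card_Diff_singleton) (auto simp: cycles_def)
  moreover have "card (cycles S ?w' - {orbit ?w' a, orbit ?w' b}) = card (cycles S ?w') - 2"
    using a bS ne S(1) by (subst card_Diff_subset) (auto simp: cycles_def)
  moreover have "card (cycles S w) > 0" using S(1) a by (auto simp: card_gt_0_iff cycles_def)
  moreover have "card (cycles S ?w') \<ge> 2"
    using card_mono[of "cycles S ?w'" "{orbit ?w' a, orbit ?w' b}"] a bS ne S(1)
    by (auto simp: cycles_def)
  ultimately show ?thesis using c(1) by simp
qed

section \<open>Absolute length and number of cycles\<close>

lemma cycles_id: "cycles S id = (\<lambda>x. {x}) ` S"
proof -
  have "orbit id x = {x}" for x :: 'a
    using orbit_eq_singleton_iff[of id x] by simp
  then show ?thesis by (simp add: cycles_def)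
qed

lemma card_cycles_id: "card (cycles S id) = card S"
  by (simp add: cycles_id card_image)

lemma transpositions_permute: "t \<in> transpositions n \<Longrightarrow> t permutes {1..n}"
  by (auto simp: transpositions_def intro: permutes_swap_id)

lemma foldr_comp_append: "foldr (\<circ>) (xs @ ys) id = foldr (\<circ>) xs id \<circ> foldr (\<circ>) ys id"
  by (induction xs) (simp_all add: comp_assoc)

text \<open>
  Fusing two cycles undoes a cut, since multiplying twice by the same transposition has no effect.
\<close>

lemma card_cycles_transpose_merge:
  assumes S: "finite S" "w permutes S" and ab: "a \<in> S" "b \<in> S" "b \<notin> orbit w a"
  shows "card (cycles S w) = Suc (card (cycles S (transpose a b \<circ> w)))"
proof -
  have "b \<noteq> a"
    using ab permutation_self_in_orbit[OF permutation_of_permutes[OF S]] by metis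
  moreover have "transpose a b \<circ> w permutes S"
    using S ab by (meson permutes_compose permutes_swap_id)
  moreover have "b \<in> orbit (transpose a b \<circ> w) a"
    using transpose_merges_orbits[OF permutation_of_permutes[OF S] ab(3)] .
  ultimately show ?thesis
    using card_cycles_transpose[OF S(1), of "transpose a b \<circ> w" a b] ab
    by (simp flip: comp_assoc)
qed

text \<open>
  The bound that makes the greedy factorisation below optimal: one transposition destroys
  at most one cycle.
\<close>

lemma cycles_foldr_transpositions:
  assumes "set ts \<subseteq> transpositions n"
  shows "foldr (\<circ>) ts id permutes {1..n} \<and> n \<le> card (cycles {1..n} (foldr (\<circ>) ts id)) + length ts"
  using assms
proof (induction ts)
  case Nil
  have "foldr (\<circ>) [] id = (id :: nat \<Rightarrow> nat)" by simp
  then show ?case by (metis add.right_neutral card_atLeastAtMost card_cycles_id diff_Suc_1 le_refl list.size(3) permutes_id)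
next
  case (Cons t ts)
  let ?w = "foldr (\<circ>) ts id"
  have w: "?w permutes {1..n}" and le: "n \<le> card (cycles {1..n} ?w) + length ts"
    using Cons.IH Cons.prems unfolding set_simps insert_subset by blast+
  obtain a b where t: "t = transpose a b" "a \<in> {1..n}" "b \<in> {1..n}" "a \<noteq> b"
    using Cons.prems by (auto simp: transpositions_def)
  have "card (cycles {1..n} ?w) \<le> Suc (card (cycles {1..n} (t \<circ> ?w)))"
    using card_cycles_transpose[OF _ w t(2)] card_cycles_transpose_merge[OF _ w t(2,3)] t(1,4)
    by (cases "b \<in> orbit ?w a") auto
  moreover have "t \<circ> ?w permutes {1..n}"
    using permutes_compose[OF w] transpositions_permute Cons.prems by simp
  ultimately have "t \<circ> ?w permutes {1..n} \<and> n \<le> card (cycles {1..n} (t \<circ> ?w)) + length (t # ts)"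
    using le by simp
  moreover have "foldr (\<circ>) (t # ts) id = t \<circ> ?w" by simp
  ultimately show ?case by metis
qed

text \<open>
  A permutation other than the identity moves some \<open>a\<close>, and multiplication by \<open>(a (w a))\<close> gives one
  more cycle, so that after \<open>n\<close> minus the number of cycles of \<open>w\<close> steps the identity is reached.
\<close>

lemma factorisation_into_transpositions:
  assumes "w permutes {1..n}"
  shows "\<exists>ts. length ts + card (cycles {1..n} w) = n \<and> set ts \<subseteq> transpositions n
           \<and> w = foldr (\<circ>) ts id"
  using assms
proof (induction "n - card (cycles {1..n} w)" arbitrary: w rule: less_induct)
  case less
  show ?case
  proof (cases "w = id")
    case True
    then show ?thesis by (intro exI[of _ "[]"]) (simp add: card_cycles_id)
  next
    case False
    then obtain a where a: "w a \<noteq> a" by (auto simp: fun_eq_iff)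
    then have aS: "a \<in> {1..n}" using less.prems by (metis permutes_not_in)
    then have bS: "w a \<in> {1..n}" using less.prems by (metis permutes_in_image)
    let ?w' = "transpose a (w a) \<circ> w"
    have w': "?w' permutes {1..n}"
      using less.prems aS bS by (meson permutes_compose permutes_swap_id)
    have c: "card (cycles {1..n} ?w') = Suc (card (cycles {1..n} w))"
      using card_cycles_transpose[OF _ less.prems aS orbit.base] a by simp
    have "card (cycles {1..n} ?w') \<le> n"
      unfolding cycles_def using card_image_le[of "{1..n}" "orbit ?w'"] by simp
    then have "n - card (cycles {1..n} ?w') < n - card (cycles {1..n} w)"
      using c by simp
    then obtain ts where "length ts + card (cycles {1..n} ?w') = n"
      "set ts \<subseteq> transpositions n" "?w' = foldr (\<circ>) ts id"
      using less.hyps[OF _ w'] by blast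
    moreover have "w = transpose a (w a) \<circ> ?w'" by (simp flip: comp_assoc)
    moreover have "transpose a (w a) \<in> transpositions n"
      using a aS bS unfolding transpositions_def by (metis (mono_tags, lifting) mem_Collect_eq)
    ultimately show ?thesis
      using c by (intro exI[of _ "transpose a (w a) # ts"]) auto
  qed
qed

lemma abs_length_le:
  "set ts \<subseteq> transpositions n \<Longrightarrow> abs_length n (foldr (\<circ>) ts id) \<le> length ts"
  unfolding abs_length_def by (rule Least_le) auto

lemma abs_length_factorisation:
  assumes "w permutes {1..n}"
  obtains ts where "length ts = abs_length n w" "set ts \<subseteq> transpositions n" "w = foldr (\<circ>) ts id"
proof -
  have "\<exists>k ts. length ts = k \<and> set ts \<subseteq> transpositions n \<and> w = foldr (\<circ>) ts id"
    using factorisation_into_transpositions[OF assms] by metis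
  then have "\<exists>ts. length ts = abs_length n w \<and> set ts \<subseteq> transpositions n \<and> w = foldr (\<circ>) ts id"
    unfolding abs_length_def by (rule LeastI_ex)
  then show ?thesis using that by blast
qed

lemma abs_length_plus_cycles:
  assumes "w permutes {1..n}"
  shows "abs_length n w + card (cycles {1..n} w) = n"
proof (rule antisym)
  show "abs_length n w + card (cycles {1..n} w) \<le> n"
    using factorisation_into_transpositions[OF assms] abs_length_le by fastforce
  show "n \<le> abs_length n w + card (cycles {1..n} w)"
    using abs_length_factorisation[OF assms] cycles_foldr_transpositions by (metis add.commute)
qed

lemma abs_length_id [simp]: "abs_length n id = 0"
  using abs_length_le[of "[]" n] by (simp add: id_def)

lemma abs_length_eq_0_iff: "w permutes {1..n} \<Longrightarrow> abs_length n w = 0 \<longleftrightarrow> w = id"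
  using abs_length_factorisation[of w n] by (metis abs_length_id foldr_Nil id_apply length_0_conv)

lemma abs_length_comp_le:
  assumes "u permutes {1..n}" "v permutes {1..n}"
  shows "abs_length n (u \<circ> v) \<le> abs_length n u + abs_length n v"
proof -
  obtain us vs where "length us = abs_length n u" "set us \<subseteq> transpositions n" "u = foldr (\<circ>) us id"
    "length vs = abs_length n v" "set vs \<subseteq> transpositions n" "v = foldr (\<circ>) vs id"
    using assms abs_length_factorisation by metis
  then show ?thesis
    using abs_length_le[of "us @ vs" n] unfolding foldr_comp_append by simp
qed

lemma cycles_inv: "permutation w \<Longrightarrow> cycles S (inv w) = cycles S w"
  by (simp add: cycles_def orbit_inv_eq)

text \<open>
  A permutation and its inverse have the same cycles as sets. Passing to the inverse replaces
  right multiplication by left multiplication in the argument for the Moebius function.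
\<close>

lemma abs_length_inv:
  assumes "w permutes {1..n}" shows "abs_length n (inv w) = abs_length n w"
  using abs_length_plus_cycles[OF assms] abs_length_plus_cycles[OF permutes_inv[OF assms]]
    cycles_inv[OF permutation_of_permutes[OF _ assms]] by simp

lemma abs_length_transpose:
  assumes w: "w permutes {1..n}" and ab: "a \<in> {1..n}" "b \<in> {1..n}" "a \<noteq> b"
  shows "b \<in> orbit w a \<Longrightarrow> abs_length n w = Suc (abs_length n (transpose a b \<circ> w))"
    and "b \<notin> orbit w a \<Longrightarrow> abs_length n (transpose a b \<circ> w) = Suc (abs_length n w)"
proof -
  have w': "transpose a b \<circ> w permutes {1..n}"
    using w ab by (meson permutes_compose permutes_swap_id)
  show "b \<in> orbit w a \<Longrightarrow> abs_length n w = Suc (abs_length n (transpose a b \<circ> w))"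
    using card_cycles_transpose[OF _ w, of a b] ab abs_length_plus_cycles[OF w]
      abs_length_plus_cycles[OF w'] by simp
  show "b \<notin> orbit w a \<Longrightarrow> abs_length n (transpose a b \<circ> w) = Suc (abs_length n w)"
    using card_cycles_transpose_merge[OF _ w, of a b] ab abs_length_plus_cycles[OF w]
      abs_length_plus_cycles[OF w'] by simp
qed

lemma abs_le_refl: "u permutes {1..n} \<Longrightarrow> abs_le n u u"
  by (simp add: abs_le_def permutes_inv_o)

lemma abs_le_antisym:
  assumes u: "u permutes {1..n}" and v: "v permutes {1..n}" and "abs_le n u v" "abs_le n v u"
  shows "u = v"
proof -
  have "abs_length n (inv u \<circ> v) = 0" using assms(3,4) by (simp add: abs_le_def)
  then have "inv u \<circ> v = id"
    using abs_length_eq_0_iff[OF permutes_compose[OF v permutes_inv[OF u]]] by simp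
  then have "u \<circ> (inv u \<circ> v) = u" by simp
  then show ?thesis using u by (simp add: permutes_inv_o flip: comp_assoc)
qed

lemma abs_le_trans:
  assumes u: "u permutes {1..n}" and v: "v permutes {1..n}" and w: "w permutes {1..n}"
    and "abs_le n u v" "abs_le n v w"
  shows "abs_le n u w"
proof -
  have "(inv u \<circ> v) \<circ> (inv v \<circ> w) = inv u \<circ> ((v \<circ> inv v) \<circ> w)" by (simp only: comp_assoc)
  then have "(inv u \<circ> v) \<circ> (inv v \<circ> w) = inv u \<circ> w" using v by (simp add: permutes_inv_o)
  then have "abs_length n (inv u \<circ> w) \<le> abs_length n (inv u \<circ> v) + abs_length n (inv v \<circ> w)"
    using abs_length_comp_le[of "inv u \<circ> v" n "inv v \<circ> w"] u v w
    by (simp add: permutes_compose permutes_inv)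
  moreover have "u \<circ> (inv u \<circ> w) = w" using u by (simp add: permutes_inv_o flip: comp_assoc)
  then have "abs_length n w \<le> abs_length n u + abs_length n (inv u \<circ> w)"
    using abs_length_comp_le[of u n "inv u \<circ> w"] u w by (simp add: permutes_compose permutes_inv)
  ultimately show ?thesis using assms(4,5) by (simp add: abs_le_def)
qed

section \<open>Sums of multiplicative cycle weights\<close>

definition cycle_weight :: "(nat \<Rightarrow> real) \<Rightarrow> 'a set \<Rightarrow> ('a \<Rightarrow> 'a) \<Rightarrow> real" where
  "cycle_weight g S w = (\<Prod>c\<in>cycles S w. g (card c))"

text \<open>
  The factor of the weight that a transposition cutting the cycle of \<open>a\<close> leaves unchanged.
\<close>

definition off_cycle_weight :: "(nat \<Rightarrow> real) \<Rightarrow> 'a set \<Rightarrow> ('a \<Rightarrow> 'a) \<Rightarrow> 'a \<Rightarrow> real" where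
  "off_cycle_weight g S w a = (\<Prod>c\<in>cycles S w - {orbit w a}. g (card c))"

lemma cycle_weight_split_off:
  "finite S \<Longrightarrow> a \<in> S \<Longrightarrow> cycle_weight g S w = g (card (orbit w a)) * off_cycle_weight g S w a"
  unfolding cycle_weight_def off_cycle_weight_def
  by (rule prod.remove) (auto simp: cycles_def)

lemma cycle_weight_transpose:
  assumes S: "finite S" "w permutes S" and a: "a \<in> S" and i: "0 < i" "i < card (orbit w a)"
  shows "cycle_weight g S (transpose a ((w ^^ i) a) \<circ> w)
    = g i * g (card (orbit w a) - i) * off_cycle_weight g S w a"
proof -
  define b where "b = (w ^^ i) a"
  define w' where "w' = transpose a b \<circ> w"
  have w: "permutation w" using S by (rule permutation_of_permutes)
  have inj: "inj_on (\<lambda>j. (w ^^ j) a) {..<card (orbit w a)}"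
    using orbit_enumeration(1)[OF w] by (rule bij_betw_imp_inj_on)
  have b: "b \<in> orbit w a" "b \<noteq> a"
    using i inj_onD[OF inj, of i 0] by (auto simp: b_def orbit_altdef)
  have bS: "b \<in> S" using permutes_orbit_subset[OF S(2) a] b(1) by auto
  have "permutation w'"
    unfolding w'_def using S a bS by (meson permutation_of_permutes permutes_compose permutes_swap_id)
  then have "b \<in> orbit w' b" by (rule permutation_self_in_orbit)
  moreover note c = cycles_transpose[OF S a b, folded w'_def]
  ultimately have ne: "orbit w' a \<noteq> orbit w' b" by auto
  define R where "R = cycles S w - {orbit w a}"
  have R: "finite R" "orbit w' a \<notin> R" "orbit w' b \<notin> R"
    unfolding R_def using S(1) c(1) by auto
  have "cycles S w' = insert (orbit w' a) (insert (orbit w' b) R)"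
    unfolding R_def c(1) using a bS by (auto simp: cycles_def)
  then have "cycle_weight g S w' = g (card (orbit w' a)) * (g (card (orbit w' b)) * off_cycle_weight g S w a)"
    unfolding cycle_weight_def off_cycle_weight_def R_def[symmetric] using R ne by simp
  then show ?thesis
    using transpose_splits_orbit(3,4)[OF w i] by (simp add: b_def w'_def)
qed

text \<open>
  The term \<open>b = a\<close> is the weight of \<open>w\<close> itself. The terms \<open>b = w\<^sup>i a\<close> with \<open>0 < i < k\<close>, where \<open>k\<close>
  is the length of the cycle of \<open>a\<close>, cut this cycle into lengths \<open>i\<close> and \<open>k - i\<close>, and the convolution
  hypothesis on \<open>g\<close> makes them add up to the opposite of the weight of \<open>w\<close>.
\<close>

lemma sum_cycle_weight_transpose:
  assumes S: "finite S" "w permutes S" and a: "a \<in> S" "w a \<noteq> a"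
    and g: "\<And>k. 2 \<le> k \<Longrightarrow> (\<Sum>i = 1..<k. g i * g (k - i)) = - g k"
  shows "(\<Sum>b\<in>orbit w a. cycle_weight g S (transpose a b \<circ> w)) = 0"
proof -
  let ?k = "card (orbit w a)"
  let ?W = "\<lambda>b. cycle_weight g S (transpose a b \<circ> w)"
  have w: "permutation w" using S by (rule permutation_of_permutes)
  note enum = orbit_enumeration[OF w, of a]
  have "?k \<noteq> 1"
    using a(2) orbit_eq_singleton_iff[of w a] permutation_self_in_orbit[OF w, of a]
    by (metis card_1_singletonE singletonD)
  then have k: "2 \<le> ?k" using enum(3) by linarith
  have "(\<Sum>b\<in>orbit w a. ?W b) = (\<Sum>i<?k. ?W ((w ^^ i) a))"
    using sum.reindex_bij_betw[OF enum(1), of ?W] by simp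
  also have "{..<?k} = insert 0 {1..<?k}" using k by auto
  also have "(\<Sum>i\<in>insert 0 {1..<?k}. ?W ((w ^^ i) a)) = ?W a + (\<Sum>i = 1..<?k. ?W ((w ^^ i) a))"
    by simp
  also have "?W a = g ?k * off_cycle_weight g S w a"
    using cycle_weight_split_off[OF S(1) a(1)] by simp
  also have "(\<Sum>i = 1..<?k. ?W ((w ^^ i) a))
    = (\<Sum>i = 1..<?k. g i * g (?k - i)) * off_cycle_weight g S w a"
    unfolding sum_distrib_right by (intro sum.cong refl cycle_weight_transpose S a) auto
  also have "\<dots> = - g ?k * off_cycle_weight g S w a" by (simp only: g[OF k])
  finally show ?thesis by linarith
qed

text \<open>
  The cycle of \<open>a\<close> is weighted as if it had \<open>j\<close> further points. These stand for points that have been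
  contracted into \<open>a\<close>; keeping track of them allows the cycle through a given point to be removed
  one point at a time.
\<close>

definition marked_weight_sum :: "(nat \<Rightarrow> real) \<Rightarrow> nat \<Rightarrow> 'a set \<Rightarrow> 'a \<Rightarrow> real" where
  "marked_weight_sum g j S a
     = (\<Sum>w | w permutes S. g (j + card (orbit w a)) * off_cycle_weight g S w a)"

lemma sum_cycle_weight_eq_marked:
  "finite S \<Longrightarrow> a \<in> S \<Longrightarrow> (\<Sum>w | w permutes S. cycle_weight g S w) = marked_weight_sum g 0 S a"
  unfolding marked_weight_sum_def by (simp add: cycle_weight_split_off)

text \<open>
  Either \<open>w\<close> fixes \<open>a\<close>, or deleting \<open>a\<close> from its cycle leaves a permutation of \<open>S\<close> in which the
  cycle of \<open>b = w a\<close> is one point shorter; the shift of \<open>j\<close> accounts for the lost point.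
\<close>

lemma marked_weight_sum_insert:
  assumes S: "finite S" and a: "a \<notin> S"
  shows "marked_weight_sum g j (insert a S) a
    = g (Suc j) * (\<Sum>w | w permutes S. cycle_weight g S w)
      + (\<Sum>b\<in>S. marked_weight_sum g (Suc j) S b)"
proof -
  let ?T = "insert a S"
  let ?f = "\<lambda>w. g (j + card (orbit w a)) * off_cycle_weight g ?T w a"
  have qa: "orbit q a = {a}" "cycles ?T q = insert {a} (cycles S q)" "{a} \<notin> cycles S q"
    if "q permutes S" for q
  proof -
    show *: "orbit q a = {a}" using that a by (simp add: orbit_eq_singleton_iff permutes_not_in)
    then show "cycles ?T q = insert {a} (cycles S q)" by (simp add: cycles_def)
    show "{a} \<notin> cycles S q"
      using permutes_orbit_subset[OF that] a by (auto simp: cycles_def)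
  qed
  have fixed: "?f q = g (Suc j) * cycle_weight g S q" if "q permutes S" for q
    using qa[OF that] by (simp add: off_cycle_weight_def cycle_weight_def)
  have inserted: "?f (transpose a b \<circ> q) = g (Suc j + card (orbit q b)) * off_cycle_weight g S q b"
    if q: "q permutes S" and b: "b \<in> S" for q b
  proof -
    define w where "w = transpose a b \<circ> q"
    have ab: "b \<noteq> a" using a b by auto
    have qT: "q permutes ?T" using q by (rule permutes_subset) auto
    have wT: "w permutes ?T"
      unfolding w_def using qT b by (meson insertI1 insertI2 permutes_compose permutes_swap_id)
    have w: "permutation w" using S wT by (intro permutation_of_permutes[of ?T]) auto
    \<comment> \<open>Deleting \<open>a\<close> from \<open>w\<close> is the cut of \<open>w\<close> by \<open>(a b)\<close> that leaves \<open>a\<close> as a fixed point.\<close>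
    have wq: "transpose a b \<circ> w = q" by (simp add: w_def flip: comp_assoc)
    have bo: "b \<in> orbit w a"
      unfolding w_def using qa(1)[OF q] ab
      by (intro transpose_merges_orbits permutation_of_permutes[OF S q]) simp
    obtain i where i: "i < card (orbit w a)" "b = (w ^^ i) a"
      using bo orbit_enumeration(1)[OF w, of a] by (auto simp: bij_betw_def)
    with ab have i0: "0 < i" by (cases i) auto
    have cards: "card (orbit q a) = i" "card (orbit q b) = card (orbit w a) - i"
      using transpose_splits_orbit(3,4)[OF w i0 i(1)] by (simp_all add: wq flip: i(2))
    then have "card (orbit w a) = Suc (card (orbit q b))"
      using qa(1)[OF q] i(1) by simp
    moreover have "cycles ?T w - {orbit w a} = cycles S q - {orbit q b}"
      using cycles_transpose(1)[OF _ wT _ bo ab] S qa[OF q] by (simp add: wq)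
    ultimately show ?thesis
      by (simp add: off_cycle_weight_def flip: w_def)
  qed
  have "marked_weight_sum g j ?T a
    = (\<Sum>b\<in>?T. \<Sum>q | q permutes S. ?f (transpose a b \<circ> q))"
    unfolding marked_weight_sum_def by (rule sum_over_permutations_insert[OF S a])
  also have "\<dots> = (\<Sum>q | q permutes S. ?f q) + (\<Sum>b\<in>S. \<Sum>q | q permutes S. ?f (transpose a b \<circ> q))"
    using S a by simp
  also have "(\<Sum>q | q permutes S. ?f q) = g (Suc j) * (\<Sum>w | w permutes S. cycle_weight g S w)"
    using fixed by (simp add: sum_distrib_left)
  also have "(\<Sum>b\<in>S. \<Sum>q | q permutes S. ?f (transpose a b \<circ> q))
    = (\<Sum>b\<in>S. marked_weight_sum g (Suc j) S b)"
    unfolding marked_weight_sum_def using inserted by (intro sum.cong refl) simp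
  finally show ?thesis .
qed

text \<open>
  The exponential formula for permutations with multiplicative cycle weights, as a recurrence: unrolling
  \<open>marked_weight_sum_insert\<close> shows that there are \<open>n! / (n - i)!\<close> ways to build the cycle of a given
  point out of \<open>i\<close> of the other \<open>n\<close> points. The statement about marked sums has to be carried along
  for all \<open>j\<close>, as the contraction step increases \<open>j\<close>.
\<close>

lemma sum_cycle_weight:
  assumes \<beta>: "\<beta> 0 = 1" "\<And>n. real (Suc n) * \<beta> (Suc n) = (\<Sum>i\<le>n. g (Suc i) * \<beta> (n - i))"
  shows "finite S \<Longrightarrow> (\<Sum>w | w permutes S. cycle_weight g S w) = fact (card S) * \<beta> (card S)"
    and "finite S \<Longrightarrow> a \<notin> S \<Longrightarrow> marked_weight_sum g j (insert a S) a
      = fact (card S) * (\<Sum>i\<le>card S. g (Suc (j + i)) * \<beta> (card S - i))"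
proof (induction "card S" arbitrary: S a j)
  case 0
  {
    case 1
    then have "S = {}" using 0 by simp
    then show ?case by (simp add: \<beta>(1) cycle_weight_def cycles_def)
  next
    case 2
    then have "S = {}" using 0 by simp
    then show ?case using marked_weight_sum_insert[of "{}" a g j]
      by (simp add: \<beta>(1) cycle_weight_def cycles_def)
  }
next
  case (Suc n)
  have A: "(\<Sum>w | w permutes S. cycle_weight g S w) = fact (card S) * \<beta> (card S)"
    if S: "finite S" "Suc n = card S" for S :: "'a set"
  proof -
    obtain a S' where S': "S = insert a S'" "a \<notin> S'" "card S' = n"
      using S(2) by (metis card_Suc_eq)
    then have fS': "finite S'" using S by simp
    have "(\<Sum>w | w permutes S. cycle_weight g S w) = fact n * (real (Suc n) * \<beta> (Suc n))"
      using sum_cycle_weight_eq_marked[OF S(1), of a g] Suc.hyps(2)[of S' a 0] S' fS'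
      using \<beta>(2)[of n] by simp
    then show ?thesis unfolding S(2)[symmetric] by (simp add: algebra_simps)
  qed
  {
    case 1
    then show ?case using A Suc.hyps by blast
  next
    case 2
    have "marked_weight_sum g (Suc j) S b = fact n * (\<Sum>i\<le>n. g (Suc (Suc j + i)) * \<beta> (n - i))"
      if b: "b \<in> S" for b
    proof -
      have "card (S - {b}) = n" using 2 Suc.hyps(3) b by simp
      then show ?thesis
        using Suc.hyps(2)[of "S - {b}" b "Suc j"] 2(1) b by (simp add: insert_absorb)
    qed
    then have "(\<Sum>b\<in>S. marked_weight_sum g (Suc j) S b)
      = fact (Suc n) * (\<Sum>i\<le>n. g (Suc (Suc j + i)) * \<beta> (n - i))"
      by (simp flip: Suc.hyps(3) add: algebra_simps)
    moreover have "(\<Sum>i\<le>Suc n. g (Suc (j + i)) * \<beta> (Suc n - i))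
      = g (Suc j) * \<beta> (Suc n) + (\<Sum>i\<le>n. g (Suc (Suc j + i)) * \<beta> (n - i))"
      by (subst sum.atMost_Suc_shift) simp
    ultimately show ?case
      using marked_weight_sum_insert[OF 2, of g j] A[OF 2(1) Suc.hyps(3)]
      by (simp flip: Suc.hyps(3) add: algebra_simps)
  }
qed

section \<open>Chains and the Moebius function\<close>

text \<open>
  Philip Hall's theorem for a poset with a least element \<open>e\<close>, in the form that sums the Moebius
  function over all elements, so that no greatest element has to be adjoined. It is proved by
  removing a maximal element \<open>m\<close>: the chains containing \<open>m\<close> correspond to the chains strictly below
  \<open>m\<close>, with opposite sign, so that by induction they contribute \<open>- (\<Sum>u<m. \<mu> u) = \<mu> m\<close>. Both posets to
  which the induction hypothesis is applied are down-closed, hence inherit the hypothesis on \<open>\<mu>\<close>.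
\<close>

lemma sum_chains_eq_sum_moebius:
  fixes \<mu> :: "'a \<Rightarrow> real"
  assumes "finite Q" "e \<in> Q"
    and refl: "\<And>x. x \<in> Q \<Longrightarrow> le x x"
    and antisym: "\<And>x y. x \<in> Q \<Longrightarrow> y \<in> Q \<Longrightarrow> le x y \<Longrightarrow> le y x \<Longrightarrow> x = y"
    and trans: "\<And>x y z. x \<in> Q \<Longrightarrow> y \<in> Q \<Longrightarrow> z \<in> Q \<Longrightarrow> le x y \<Longrightarrow> le y z \<Longrightarrow> le x z"
    and bot: "\<And>x. x \<in> Q \<Longrightarrow> le e x"
    and moebius: "\<And>w. w \<in> Q \<Longrightarrow> (\<Sum>u | u \<in> Q \<and> le u w. \<mu> u) = (if w = e then 1 else 0)"
  shows "(\<Sum>F\<in>order_complex (Q - {e}) le. (-1) ^ card F) = (\<Sum>w\<in>Q. \<mu> w)"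
  using assms
proof (induction "card Q" arbitrary: Q rule: less_induct)
  case less
  note [simp] = \<open>finite Q\<close>
  show ?case
  proof (cases "Q = {e}")
    case True
    have "{u. u \<in> Q \<and> le u e} = {e}" using True less.prems(3)[of e] by auto
    then have "\<mu> e = 1" using less.prems(7)[OF less.prems(2)] by simp
    moreover have "order_complex (Q - {e}) le = {{}}"
      using True by (auto simp: order_complex_def chain_empty)
    ultimately show ?thesis using True by simp
  next
    case False
    obtain m where m: "m \<in> Q" "m \<noteq> e" and max: "\<And>x. x \<in> Q \<Longrightarrow> x \<noteq> m \<Longrightarrow> \<not> le m x"
    proof -
      \<comment> \<open>An element with the largest number of elements below it is maximal.\<close>
      define h where "h x = card {y \<in> Q. le y x}" for x
      have "finite (Q - {e})" "Q - {e} \<noteq> {}" using False less.prems(2) by auto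
      then have "finite (h ` (Q - {e}))" "Max (h ` (Q - {e})) \<in> h ` (Q - {e})"
        by (simp_all add: Max_in)
      then obtain m where m: "m \<in> Q - {e}" "\<And>x. x \<in> Q - {e} \<Longrightarrow> h x \<le> h m"
        by (metis (no_types, lifting) Max_ge imageE imageI)
      have "\<not> le m x" if "x \<in> Q" "x \<noteq> m" for x
      proof
        assume "le m x"
        with that have x: "x \<in> Q" "le m x" "x \<noteq> m" by simp_all
        have nle: "\<not> le x m" using less.prems(4) m(1) x by auto
        moreover have "{y \<in> Q. le y m} \<subseteq> {y \<in> Q. le y x}"
          using less.prems(5)[of _ m x] m(1) x by auto
        ultimately have "{y \<in> Q. le y m} \<subset> {y \<in> Q. le y x}"
          using less.prems(3)[of x] x(1) by auto
        then have "h m < h x" unfolding h_def by (intro psubset_card_mono) auto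
        moreover have "x \<noteq> e" using nle less.prems(6) m(1) by auto
        ultimately show False using m(2)[of x] x(1) by auto
      qed
      then show ?thesis using that[of m] m(1) by simp
    qed
    have IH: "(\<Sum>F\<in>order_complex (D - {e}) le. (-1) ^ card F) = (\<Sum>w\<in>D. \<mu> w)"
      if D: "D \<subset> Q" "e \<in> D" and down: "\<And>x y. x \<in> D \<Longrightarrow> y \<in> Q \<Longrightarrow> le y x \<Longrightarrow> y \<in> D" for D
    proof (rule less.hyps)
      show "card D < card Q" using D by (simp add: psubset_card_mono)
      show "finite D" using D finite_subset[of D Q] by auto
      fix w assume w: "w \<in> D"
      then have "{u \<in> D. le u w} = {u \<in> Q. le u w}" using D down by blast
      then show "(\<Sum>u | u \<in> D \<and> le u w. \<mu> u) = (if w = e then 1 else 0)"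
        using less.prems(7)[of w] w D by auto
    next
      have mem: "x \<in> Q" if "x \<in> D" for x using D(1) that by auto
      show "le x x" if "x \<in> D" for x using less.prems(3) mem that by simp
      show "x = y" if "x \<in> D" "y \<in> D" "le x y" "le y x" for x y
        using less.prems(4)[of x y] mem that by simp
      show "le x z" if "x \<in> D" "y \<in> D" "z \<in> D" "le x y" "le y z" for x y z
        using less.prems(5)[of x y z] mem that by simp
      show "le e x" if "x \<in> D" for x using less.prems(6) mem that by simp
    qed (rule D(2))
    define B where "B = {x \<in> Q - {m}. le x m}"
    have IH1: "(\<Sum>F\<in>order_complex (Q - {m} - {e}) le. (-1) ^ card F) = (\<Sum>w\<in>Q - {m}. \<mu> w)"
    proof (rule IH)
      show "Q - {m} \<subset> Q" "e \<in> Q - {m}" using m less.prems(2) by auto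
      show "y \<in> Q - {m}" if "x \<in> Q - {m}" "y \<in> Q" "le y x" for x y
        using max[of x] that by auto
    qed
    have IH2: "(\<Sum>F\<in>order_complex (B - {e}) le. (-1) ^ card F) = (\<Sum>w\<in>B. \<mu> w)"
    proof (rule IH)
      show "B \<subset> Q" "e \<in> B" using m less.prems(2) less.prems(6)[of m] by (auto simp: B_def)
    next
      fix x y assume "x \<in> B" "y \<in> Q" "le y x"
      then show "y \<in> B" using less.prems(5)[of y x m] less.prems(4)[of x m] m(1) by (auto simp: B_def)
    qed
    have split: "order_complex (Q - {e}) le =
      order_complex (Q - {m} - {e}) le \<union> insert m ` order_complex (B - {e}) le"
    proof (intro set_eqI iffI)
      fix F assume F: "F \<in> order_complex (Q - {e}) le"
      show "F \<in> order_complex (Q - {m} - {e}) le \<union> insert m ` order_complex (B - {e}) le"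
      proof (cases "m \<in> F")
        case True
        have chain: "le x m" if "x \<in> F" "x \<noteq> m" for x
          using that F True max[of x] by (auto simp: order_complex_def chain_def)
        have "F - {m} \<subseteq> B - {e}" "Complete_Partial_Order.chain le (F - {m})"
          using F chain by (auto simp: order_complex_def B_def intro: chain_subset)
        then have "F - {m} \<in> order_complex (B - {e}) le" by (simp add: order_complex_def)
        then show ?thesis using True by (metis UnI2 image_eqI insert_Diff)
      next
        case False
        then show ?thesis using F by (auto simp: order_complex_def)
      qed
    next
      fix F assume "F \<in> order_complex (Q - {m} - {e}) le \<union> insert m ` order_complex (B - {e}) le"
      then show "F \<in> order_complex (Q - {e}) le"
        using m less.prems(3)[OF m(1)] by (auto simp: order_complex_def chain_def B_def)
    qed
    have fin: "finite (order_complex X le)" if "X \<subseteq> Q" for X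
      by (rule finite_subset[of _ "Pow Q"]) (use that in \<open>auto simp: order_complex_def\<close>)
    have notin: "m \<notin> F" "finite F" if "F \<in> order_complex (B - {e}) le" for F
      using that finite_subset[of F Q] by (auto simp: order_complex_def B_def)
    have "inj_on (insert m) (order_complex (B - {e}) le)"
      using notin by (intro inj_onI) (metis Diff_insert_absorb)
    then have "(\<Sum>F\<in>insert m ` order_complex (B - {e}) le. (-1) ^ card F)
      = (\<Sum>F\<in>order_complex (B - {e}) le. - ((-1::real) ^ card F))"
      using notin by (subst sum.reindex) (auto intro!: sum.cong)
    also have "\<dots> = - (\<Sum>w\<in>B. \<mu> w)" using IH2 by (simp add: sum_negf)
    also have "\<dots> = \<mu> m"
    proof -
      have "{u. u \<in> Q \<and> le u m} = insert m B" using m less.prems(3) by (auto simp: B_def)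
      then show ?thesis using less.prems(7)[OF m(1)] m by (simp add: B_def)
    qed
    finally have "(\<Sum>F\<in>order_complex (Q - {e}) le. (-1) ^ card F) = (\<Sum>w\<in>Q - {m}. \<mu> w) + \<mu> m"
      unfolding split IH1[symmetric]
      by (subst sum.union_disjoint) (auto intro!: fin finite_imageI simp: B_def order_complex_def)
    also have "\<dots> = (\<Sum>w\<in>Q. \<mu> w)" using m by (simp add: sum.remove[of Q m])
    finally show ?thesis .
  qed
qed

section \<open>The Catalan generating function\<close>

text \<open>
  Squaring the closed form clears the root, and the common factor \<open>4 t\<close> can be cancelled because
  formal power series over the reals form an integral domain.
\<close>

lemma catalan_fps_quadratic: "catalan_fps = 1 + fps_X * catalan_fps ^ 2"
proof -
  let ?S = "fps_radical root 2 (1 - 4 * fps_X) :: real fps"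
  have "?S ^ 2 = 1 - 4 * fps_X"
    using iffD1[OF power_radical[of "1 - 4 * fps_X :: real fps" root 1]] by (simp add: numeral_2_eq_2)
  moreover have "?S = 1 - 2 * fps_X * catalan_fps" using catalan_fps_closed_form by simp
  ultimately have "(1 - 2 * fps_X * catalan_fps) ^ 2 = (1 - 4 * fps_X :: real fps)" by simp
  then have "(4 * fps_X) * (1 + fps_X * catalan_fps ^ 2 - catalan_fps) = (0 :: real fps)"
    by (simp add: power2_eq_square algebra_simps)
  moreover have "(4 * fps_X :: real fps) \<noteq> 0" by simp
  ultimately have "1 + fps_X * catalan_fps ^ 2 - catalan_fps = (0 :: real fps)"
    by (metis mult_eq_0_iff)
  then show ?thesis by simp
qed

lemma catalan_convolution: "catalan (Suc n) = (\<Sum>i\<le>n. catalan i * catalan (n - i))"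
proof -
  have "catalan (Suc n) = fps_nth (1 + fps_X * catalan_fps ^ 2) (Suc n)"
    using catalan_fps_quadratic by (metis catalan_fps_def fps_nth_Abs_fps)
  also have "\<dots> = fps_nth (catalan_fps * catalan_fps) n" by (simp add: power2_eq_square)
  finally show ?thesis
    by (simp add: power2_eq_square fps_mult_nth catalan_fps_def atLeast0AtMost)
qed

text \<open>
  Differentiating \<open>C = 1 + t C\<^sup>2\<close> gives \<open>C' - 2 t C C' = C\<^sup>2\<close>. The logarithmic derivative of \<open>Y\<close> is
  \<open>C' / C - 2 C - 2 t C'\<close>, which is therefore \<open>C - 2 C = - C\<close>.
\<close>

lemma catalan_exp_deriv:
  defines "Y \<equiv> catalan_fps * (fps_exp 1 oo (- 2 * fps_X * catalan_fps))"
  shows "fps_deriv Y = - catalan_fps * Y" and "fps_nth Y 0 = 1"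
proof -
  let ?C = catalan_fps
  define E where "E = fps_exp 1 oo (- 2 * fps_X * ?C)"
  have C: "fps_deriv ?C = ?C ^ 2 + 2 * fps_X * ?C * fps_deriv ?C"
    using arg_cong[OF catalan_fps_quadratic, of fps_deriv]
    by (simp add: power2_eq_square algebra_simps)
  have E: "fps_deriv E = - 2 * (?C + fps_X * fps_deriv ?C) * E"
    unfolding E_def by (subst fps_compose_deriv) (simp_all add: algebra_simps)
  have "fps_deriv Y = (fps_deriv ?C - 2 * ?C ^ 2 - 2 * fps_X * ?C * fps_deriv ?C) * E"
    unfolding Y_def E_def[symmetric] by (simp add: E power2_eq_square algebra_simps)
  also have "\<dots> = - (?C ^ 2 * E)" 
  proof -
    have "D - 2 * ?C ^ 2 - R = - (?C ^ 2)" if "D = ?C ^ 2 + R" for D R :: "real fps"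
      using that by simp
    from this[OF C] show ?thesis by (simp only: mult_minus_left)
  qed
  finally show "fps_deriv Y = - ?C * Y" by (simp add: Y_def E_def power2_eq_square algebra_simps)
  show "fps_nth Y 0 = 1" by (simp add: Y_def catalan_fps_def catalan_0)
qed

section \<open>The Moebius function of the absolute order\<close>

text \<open>
  The Moebius number of the lattice of noncrossing partitions of \<open>k\<close> points, for \<open>k > 0\<close>.
\<close>

definition signed_catalan :: "nat \<Rightarrow> real" where
  "signed_catalan k = (-1) ^ (k - 1) * catalan (k - 1)"

lemma signed_catalan_convolution:
  assumes "2 \<le> k"
  shows "(\<Sum>i = 1..<k. signed_catalan i * signed_catalan (k - i)) = - signed_catalan k"
proof -
  obtain m where k: "k = Suc (Suc m)" using assms by (metis add_2_eq_Suc le_Suc_ex)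
  have "(\<Sum>i = 1..<k. signed_catalan i * signed_catalan (k - i))
    = (\<Sum>i\<le>m. signed_catalan (Suc i) * signed_catalan (Suc m - i))"
    by (rule sum.reindex_bij_witness[of _ Suc "\<lambda>i. i - 1"]) (auto simp: k)
  also have "\<dots> = (\<Sum>i\<le>m. (-1) ^ m * (catalan i * catalan (m - i)))"
  proof (rule sum.cong[OF refl])
    fix i assume "i \<in> {..m}"
    then have "(-1 :: real) ^ i * (-1) ^ (m - i) = (-1) ^ m" by (simp flip: power_add)
    then show "signed_catalan (Suc i) * signed_catalan (Suc m - i)
      = (-1) ^ m * (catalan i * catalan (m - i))"
      by (simp add: signed_catalan_def)
  qed
  also have "\<dots> = - signed_catalan k"
    by (simp add: k signed_catalan_def catalan_convolution sum_distrib_left sum_negf)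
  finally show ?thesis .
qed

abbreviation absolute_moebius :: "nat \<Rightarrow> (nat \<Rightarrow> nat) \<Rightarrow> real" where
  "absolute_moebius n \<equiv> cycle_weight signed_catalan {1..n}"

text \<open>
  Let \<open>a\<close> be a point moved by \<open>w\<close>. With \<open>v = u\<^sup>-\<^sup>1 w\<close> the sum runs over those \<open>v\<close> for which the
  lengths of \<open>v w\<^sup>-\<^sup>1 = u\<^sup>-\<^sup>1\<close> and \<open>v\<close> add up to the length of \<open>w\<close>. Write \<open>v = (a b) q\<close> with \<open>q\<close>
  fixing \<open>a\<close>, and keep \<open>q\<close> fixed while \<open>b\<close> varies. If \<open>b \<noteq> a\<close>, the passage from \<open>q\<close> to \<open>v\<close> increases
  the length, so that the length condition requires the factor \<open>(a b)\<close> to decrease the length of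
  \<open>q w\<^sup>-\<^sup>1\<close>: this means that \<open>b\<close> lies on the cycle of \<open>a\<close> under \<open>q w\<^sup>-\<^sup>1\<close>, and the condition then no
  longer depends on \<open>b\<close>. Since \<open>q\<close> fixes \<open>a\<close> and \<open>w\<close> does not, \<open>q w\<^sup>-\<^sup>1\<close> moves \<open>a\<close>, so that the sum
  over \<open>b\<close> vanishes by \<open>sum_cycle_weight_transpose\<close>.
\<close>

lemma sum_absolute_moebius_below:
  assumes w: "w permutes {1..n}"
  shows "(\<Sum>u | u \<in> sym_perms n \<and> abs_le n u w. absolute_moebius n u) = (if w = id then 1 else 0)"
proof (cases "w = id")
  case True
  have "{u. u \<in> sym_perms n \<and> abs_le n u w} = {id}"
    using True abs_le_refl[of id n]
    by (auto simp: sym_perms_def abs_le_def abs_length_eq_0_iff permutes_id)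
  moreover have "absolute_moebius n id = 1"
    unfolding cycle_weight_def cycles_id
    by (intro prod.neutral) (auto simp: signed_catalan_def catalan_0)
  ultimately show ?thesis using True by simp
next
  case False
  let ?\<nu> = "absolute_moebius n" and ?S = "{1..n}" and ?len = "abs_length n"
  obtain a where a: "w a \<noteq> a" using False by (auto simp: fun_eq_iff)
  then have aS: "a \<in> ?S" using w by (metis permutes_not_in)
  let ?S' = "?S - {a}"
  have Sins: "insert a ?S' = ?S" using aS by auto
  have iw: "inv w permutes ?S" using w by (rule permutes_inv)
  define T where "T v = (if ?len (v \<circ> inv w) + ?len v = ?len w then ?\<nu> (v \<circ> inv w) else 0)" for v
  have "(\<Sum>u | u \<in> sym_perms n \<and> abs_le n u w. ?\<nu> u)
    = (\<Sum>u | u permutes ?S. if abs_le n u w then ?\<nu> u else 0)"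
    using finite_permutations[of ?S]
    by (subst sum.inter_filter[symmetric]) (auto simp: sym_perms_def)
  also have "\<dots> = (\<Sum>v | v permutes ?S. T v)"
  proof (rule sum.reindex_bij_witness[of _ "\<lambda>v. w \<circ> inv v" "\<lambda>u. inv u \<circ> w"])
    fix u assume "u \<in> {u. u permutes ?S}"
    then have u: "u permutes ?S" by simp
    have "inv (inv u \<circ> w) = inv w \<circ> u"
      using o_inv_distrib[OF bij_imp_bij_inv[OF permutes_bij[OF u]] permutes_bij[OF w]]
        inv_inv_eq[OF permutes_bij[OF u]] by simp
    then show "w \<circ> inv (inv u \<circ> w) = u"
      using w by (simp add: permutes_inv_o flip: comp_assoc)
    show "inv u \<circ> w \<in> {v. v permutes ?S}" using u w by (simp add: permutes_compose permutes_inv)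
    have "inv u \<circ> w \<circ> inv w = inv u" using w by (simp add: permutes_inv_o comp_assoc)
    moreover have "?\<nu> (inv u) = ?\<nu> u"
      unfolding cycle_weight_def using cycles_inv[OF permutation_of_permutes[OF _ u]] by simp
    ultimately show "T (inv u \<circ> w) = (if abs_le n u w then ?\<nu> u else 0)"
      using abs_length_inv[OF u] by (simp add: T_def abs_le_def)
  next
    fix v assume "v \<in> {v. v permutes ?S}"
    then have v: "v permutes ?S" by simp
    then show "w \<circ> inv v \<in> {u. u permutes ?S}" using w by (simp add: permutes_compose permutes_inv)
    have "inv (w \<circ> inv v) = v \<circ> inv w"
      using o_inv_distrib[OF permutes_bij[OF w] bij_imp_bij_inv[OF permutes_bij[OF v]]]
        inv_inv_eq[OF permutes_bij[OF v]] by simp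
    then show "inv (w \<circ> inv v) \<circ> w = v"
      using w by (simp add: permutes_inv_o comp_assoc)
  qed
  also have "\<dots> = (\<Sum>b\<in>?S. \<Sum>q | q permutes ?S'. T (transpose a b \<circ> q))"
    using sum_over_permutations_insert[of ?S' a T] by (simp only: Sins) simp
  also have "\<dots> = (\<Sum>q | q permutes ?S'. \<Sum>b\<in>?S. T (transpose a b \<circ> q))"
    by (rule sum.swap)
  also have "\<dots> = 0"
  proof (rule sum.neutral, rule ballI)
    fix q assume "q \<in> {q. q permutes ?S'}"
    then have q': "q permutes ?S'" by simp
    have q: "q permutes ?S" using q' by (rule permutes_subset) auto
    have qa: "q a = a" using q' by (simp add: permutes_not_in)
    define x where "x = q \<circ> inv w"
    have x: "x permutes ?S" unfolding x_def using iw q by (rule permutes_compose)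
    have "x a \<noteq> a"
    proof
      assume "x a = a"
      then have "q (inv w a) = q a" using qa by (simp add: x_def)
      then have "inv w a = a" using permutes_inj[OF q] by (simp add: inj_eq)
      then show False using a w by (metis permutes_inverses(1))
    qed
    have xo: "a \<in> orbit x a"
      using x permutation_self_in_orbit permutation_of_permutes by (metis finite_atLeastAtMost)
    have oS: "orbit x a \<subseteq> ?S" using x aS by (rule permutes_orbit_subset)
    \<comment> \<open>This excludes the case that both factors get longer when multiplied by \<open>(a b)\<close>.\<close>
    have lw: "?len w \<le> ?len x + ?len q"
    proof -
      have "inv w = inv q \<circ> x"
        using q by (simp add: x_def permutes_inv_o flip: comp_assoc)
      then have "?len (inv w) \<le> ?len (inv q) + ?len x"
        using abs_length_comp_le[OF permutes_inv[OF q] x] by simp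
      then show ?thesis using abs_length_inv[OF q] abs_length_inv[OF w] by simp
    qed
    have T: "T (transpose a b \<circ> q)
        = (if b \<in> orbit x a \<and> ?len x + ?len q = ?len w then ?\<nu> (transpose a b \<circ> x) else 0)"
      if b: "b \<in> ?S" for b
    proof (cases "b = a")
      case True
      then show ?thesis using xo by (simp add: T_def x_def)
    next
      case False
      then have "b \<notin> orbit q a" using qa orbit_eq_singleton_iff[of q a] by auto
      then have lq: "?len (transpose a b \<circ> q) = Suc (?len q)"
        using abs_length_transpose(2)[OF q aS b] False by simp
      show ?thesis
        using abs_length_transpose[OF x aS b] False lq lw
        by (cases "b \<in> orbit x a") (auto simp: T_def x_def comp_assoc)
    qed
    have "(\<Sum>b\<in>?S. T (transpose a b \<circ> q))
      = (\<Sum>b\<in>?S. if b \<in> orbit x a \<and> ?len x + ?len q = ?len w then ?\<nu> (transpose a b \<circ> x) else 0)"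
      using T by (rule sum.cong[OF refl])
    also have "\<dots> = (if ?len x + ?len q = ?len w then \<Sum>b\<in>orbit x a. ?\<nu> (transpose a b \<circ> x) else 0)"
    proof (cases "?len x + ?len q = ?len w")
      case True
      have "(\<Sum>b\<in>?S. if b \<in> orbit x a then ?\<nu> (transpose a b \<circ> x) else 0)
        = (\<Sum>b\<in>?S \<inter> orbit x a. ?\<nu> (transpose a b \<circ> x))"
        by (rule sum.inter_restrict[symmetric]) simp
      moreover have "?S \<inter> orbit x a = orbit x a" using oS by blast
      ultimately show ?thesis using True by simp
    next
      case False
      then show ?thesis by simp
    qed
    also have "\<dots> = 0"
      using sum_cycle_weight_transpose[OF _ x aS \<open>x a \<noteq> a\<close> signed_catalan_convolution] by simp
    finally show "(\<Sum>b\<in>?S. T (transpose a b \<circ> q)) = 0" .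
  qed
  finally show ?thesis using False by simp
qed

lemma reduced_euler_char_eq_sum_moebius:
  "reduced_euler_char (order_complex (sym_perms n - {id}) (abs_le n))
    = - (\<Sum>w\<in>sym_perms n. absolute_moebius n w)"
proof -
  let ?\<Delta> = "order_complex (sym_perms n - {id}) (abs_le n)"
  have "reduced_euler_char ?\<Delta> = (\<Sum>F\<in>?\<Delta>. - ((-1) ^ card F))"
    unfolding reduced_euler_char_def face_dim_def by (simp add: power_int_diff)
  also have "\<dots> = - (\<Sum>F\<in>?\<Delta>. (-1) ^ card F)" by (rule sum_negf)
  also have "(\<Sum>F\<in>?\<Delta>. (-1) ^ card F) = (\<Sum>w\<in>sym_perms n. absolute_moebius n w)"
  proof (rule sum_chains_eq_sum_moebius)
    show "finite (sym_perms n)" by (simp add: sym_perms_def finite_permutations)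
    show "id \<in> sym_perms n" by (simp add: sym_perms_def permutes_id)
  next
    fix x y z assume "x \<in> sym_perms n" "y \<in> sym_perms n" "z \<in> sym_perms n" "abs_le n x y" "abs_le n y z"
    then show "abs_le n x z" using abs_le_trans[of x n y z] by (simp add: sym_perms_def)
  next
    fix w assume "w \<in> sym_perms n"
    then show "(\<Sum>u | u \<in> sym_perms n \<and> abs_le n u w. absolute_moebius n u) = (if w = id then 1 else 0)"
      by (intro sum_absolute_moebius_below) (simp add: sym_perms_def)
  next
    fix x y assume "x \<in> sym_perms n" "y \<in> sym_perms n" "abs_le n x y" "abs_le n y x"
    then show "x = y" using abs_le_antisym[of x n y] by (simp add: sym_perms_def)
  qed (simp_all add: sym_perms_def abs_le_refl, simp add: abs_le_def)
  finally show ?thesis .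
qed

theorem theorem1p2:
  shows "Abs_fps (\<lambda>n. if n \<ge> 1
             then (-1) ^ n * reduced_euler_char (order_complex (sym_perms n - {id}) (abs_le n)) / fact n
             else 0)
         = 1 - catalan_fps * (fps_exp 1 oo (- 2 * fps_X * catalan_fps))"
proof (rule fps_ext)
  fix n
  define Y :: "real fps" where "Y = catalan_fps * (fps_exp 1 oo (- 2 * fps_X * catalan_fps))"
  \<comment> \<open>The sign \<open>(-1) ^ n\<close> is absorbed into the Catalan weights, which thereby become \<open>signed_catalan\<close>.\<close>
  define \<beta> where "\<beta> k = (-1) ^ k * fps_nth Y k" for k
  have Y0: "fps_nth Y 0 = 1" unfolding Y_def by (rule catalan_exp_deriv(2))
  have "real (Suc k) * \<beta> (Suc k) = (\<Sum>i\<le>k. signed_catalan (Suc i) * \<beta> (k - i))" for k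
  proof -
    have "real (Suc k) * fps_nth Y (Suc k) = fps_nth (- catalan_fps * Y) k"
      unfolding catalan_exp_deriv(1)[folded Y_def, symmetric] by simp
    also have "\<dots> = - (\<Sum>i\<le>k. catalan i * fps_nth Y (k - i))"
      by (simp add: fps_mult_nth atLeast0AtMost catalan_fps_def sum_negf)
    finally have Y: "real (Suc k) * fps_nth Y (Suc k) = - (\<Sum>i\<le>k. catalan i * fps_nth Y (k - i))" .
    have "real (Suc k) * \<beta> (Suc k) = - ((-1) ^ k * (real (Suc k) * fps_nth Y (Suc k)))"
      by (simp add: \<beta>_def)
    also have "\<dots> = (\<Sum>i\<le>k. (-1) ^ k * (catalan i * fps_nth Y (k - i)))"
      unfolding Y by (simp add: sum_distrib_left)
    also have "\<dots> = (\<Sum>i\<le>k. signed_catalan (Suc i) * \<beta> (k - i))"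
    proof (rule sum.cong[OF refl])
      fix i assume "i \<in> {..k}"
      then have "(-1 :: real) ^ k = (-1) ^ i * (-1) ^ (k - i)" by (simp flip: power_add)
      then show "(-1) ^ k * (catalan i * fps_nth Y (k - i)) = signed_catalan (Suc i) * \<beta> (k - i)"
        by (simp add: signed_catalan_def \<beta>_def)
    qed
    finally show ?thesis .
  qed
  then have "(\<Sum>w\<in>sym_perms n. absolute_moebius n w) = fact n * \<beta> n"
    using sum_cycle_weight(1)[of \<beta> signed_catalan "{1..n}"] Y0 by (simp add: sym_perms_def \<beta>_def)
  then have "(-1) ^ n * reduced_euler_char (order_complex (sym_perms n - {id}) (abs_le n)) / fact n
    = - fps_nth Y n"
    unfolding reduced_euler_char_eq_sum_moebius by (simp add: \<beta>_def flip: mult.assoc power_add)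
  then show "fps_nth (Abs_fps (\<lambda>n. if n \<ge> 1
             then (-1) ^ n * reduced_euler_char (order_complex (sym_perms n - {id}) (abs_le n)) / fact n
             else 0)) n
         = fps_nth (1 - catalan_fps * (fps_exp 1 oo (- 2 * fps_X * catalan_fps))) n"
    \<comment> \<open>For \<open>n = 0\<close> both sides vanish because \<open>Y\<close> has constant term 1.\<close>
    unfolding Y_def[symmetric] using Y0 by (cases "n = 0") simp_all
qed

end
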